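(* Let $k>1$, $A=\mathbb{Z}_2^k$, and let $T$ be a caterpillar with spine path $s_1s_2s_3$ and $|V(T)|=2^k$, where $X,Y,Z$ are the sets of leaves attached to $s_1,s_2,s_3$ respectively. Then $T$ is $A$-rainbow if and only if $|X|$ and $|Z|$ are even and $|Y|$ is odd.
   Context: For an Abelian group $A$ and a tree $T$ with $|V(T)|=|A|$, a labeling $f\colon V(T)\to A$ induces the edge labeling $uv\mapsto f(u)+f(v)$. $f$ is an $A$-rainbow labeling if $f$ is a bijection and all edges receive distinct labels; $T$ is $A$-rainbow if it admits such a labeling. *)

theory Defs
  imports "Graph_Theory.Graph_Theory" "HOL-Algebra.Elementary_Groups" "HOL-Algebra.Product_Groups"
begin

text \<open>
  A finite simple undirected graph is a \<^locale>\<open>pair_graph\<close>: its arc set is a finite irreflexive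
  symmetric relation, and the edge \<open>uv\<close> is represented by the two arcs \<open>(u, v)\<close> and \<open>(v, u)\<close>.

  The predicate \<open>tree\<close> of the graph library forbids all directed cycles, including \<open>u, v, u\<close>, and
  so is not the undirected notion on symmetric digraphs. Since the vertices on a cycle are distinct,
  the cycles of the underlying undirected graph are exactly the directed ones of length at least 3.
\<close>

definition undirected_tree :: "'v pair_pre_digraph \<Rightarrow> bool" where
  "undirected_tree T \<longleftrightarrow> pair_graph T \<and> Digraph_Component.connected (with_proj T) \<and>
     \<not> (\<exists>p. pre_digraph.cycle (with_proj T) p \<and> 3 \<le> length p)"

text \<open>In a symmetric digraph, the out-degree of a vertex is its undirected degree.\<close>

definition leaf :: "'v pair_pre_digraph \<Rightarrow> 'v \<Rightarrow> bool" where
  "leaf T v \<longleftrightarrow> v \<in> pverts T \<and> out_degree (with_proj T) v = 1"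

definition attached_leaves :: "'v pair_pre_digraph \<Rightarrow> 'v list \<Rightarrow> 'v \<Rightarrow> 'v set" where
  "attached_leaves T ss s = {v \<in> pverts T - set ss. leaf T v \<and> (s, v) \<in> parcs T}"

text \<open>
  Every vertex off the spine path is a leaf attached to a vertex of the spine. The ends of the spine
  are allowed to have no attached leaves.
\<close>

definition caterpillar_with_spine :: "'v pair_pre_digraph \<Rightarrow> 'v list \<Rightarrow> bool" where
  "caterpillar_with_spine T ss \<longleftrightarrow> undirected_tree T \<and> vpath ss (with_proj T) \<and>
     (\<forall>v \<in> pverts T - set ss. \<exists>s \<in> set ss. v \<in> attached_leaves T ss s)"

text \<open>
  The group operation of \<open>A\<close>, written additively in the mathematics, is the multiplication of the
  monoid record. The arcs \<open>(u, v)\<close> and \<open>(v, u)\<close> are the same edge, so distinctness is required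
  only for arcs with different sets of end points.
\<close>

definition rainbow_labeling ::
    "('a, 'b) monoid_scheme \<Rightarrow> 'v pair_pre_digraph \<Rightarrow> ('v \<Rightarrow> 'a) \<Rightarrow> bool" where
  "rainbow_labeling A T f \<longleftrightarrow> bij_betw f (pverts T) (carrier A) \<and>
     (\<forall>(u, v) \<in> parcs T. \<forall>(x, y) \<in> parcs T.
        {u, v} \<noteq> {x, y} \<longrightarrow> f u \<otimes>\<^bsub>A\<^esub> f v \<noteq> f x \<otimes>\<^bsub>A\<^esub> f y)"

definition rainbow :: "('a, 'b) monoid_scheme \<Rightarrow> 'v pair_pre_digraph \<Rightarrow> bool" where
  "rainbow A T \<longleftrightarrow> (\<exists>f. rainbow_labeling A T f)"

definition Z2_power :: "nat \<Rightarrow> (nat \<Rightarrow> int) monoid" where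
  "Z2_power k = product_group {..<k} (\<lambda>_. integer_mod_group 2)"

lemma comm_group_Z2_power: "comm_group (Z2_power k)"
proof -
  have "group (Z2_power k)"
    by (simp add: Z2_power_def)
  moreover have "x \<otimes>\<^bsub>Z2_power k\<^esub> y = y \<otimes>\<^bsub>Z2_power k\<^esub> x" for x y
    by (simp add: Z2_power_def add.commute)
  ultimately show ?thesis
    by (simp add: group.group_comm_groupI)
qed

lemma order_Z2_power: "order (Z2_power k) = 2 ^ k"
  by (simp add: order_def Z2_power_def carrier_integer_mod_group card_PiE)

end

theory Submission
  imports Defs "HOL-Algebra.FiniteProduct"
begin

text \<open>
  Root the caterpillar at \<open>s2\<close>, and write \<open>a, b, c\<close> for the labels of \<open>s1, s2, s3\<close>. The labels of the
  edges are distinct and nonzero, and there are \<open>|A| - 1\<close> of them, so every nonzero element of \<open>A\<close>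
  occurs. Summing the edge labels and comparing with the sum of the vertex labels gives
  \<open>|X| a + |Y| b + |Z| c = b\<close>. Since \<open>|X| + |Y| + |Z|\<close> is odd and \<open>a, b, c\<close> are distinct, this forces
  the stated parities.

  Conversely put \<open>b = 0\<close>. It suffices to find disjoint sets \<open>X, Z\<close> of the required even sizes outside
  \<open>H = {0, a, c, a + c}\<close> with \<open>(a + X) \<union> (c + Z) = X \<union> Z\<close>, as the labels of the remaining edges are
  those of their lower ends. These sets are collected coset by coset of \<open>H\<close>: a coset can be given
  to \<open>X\<close> or to \<open>Z\<close> (half of it for a last single pair), or be shared by giving one diagonal of the square \<open>w, w + a, w + a + c, w + c\<close>
  to \<open>X\<close> and the other one to \<open>Z\<close>.
\<close>

section \<open>Elementary abelian 2-groups and exchanges inside them\<close>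

locale elementary_abelian_2_group = comm_group G for G (structure) +
  assumes square_one: "x \<in> carrier G \<Longrightarrow> x \<otimes> x = \<one>"
begin

lemma mult_self_cancel [simp]: "a \<in> carrier G \<Longrightarrow> x \<in> carrier G \<Longrightarrow> a \<otimes> (a \<otimes> x) = x"
  by (simp add: m_assoc [symmetric] square_one)

lemma mult_eq_one_iff: "x \<in> carrier G \<Longrightarrow> y \<in> carrier G \<Longrightarrow> x \<otimes> y = \<one> \<longleftrightarrow> x = y"
  by (metis mult_self_cancel r_one square_one)

lemma pow_parity: "x \<in> carrier G \<Longrightarrow> x [^] n = (if even n then \<one> else x)" for n :: nat
  by (induction n) (auto simp: square_one)

text \<open>\<open>X\<close> and \<open>Z\<close> are meant as label sets for the leaves at the
  vertices labelled \<open>a\<close> and \<open>c\<close>; the two images are then the labels of the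
  edges to these leaves. Such edges reuse exactly the labels of their leaves, leaving the remaining
  labels to the other edges.\<close>

definition exchange :: "'a \<Rightarrow> 'a \<Rightarrow> 'a set \<Rightarrow> 'a set \<Rightarrow> bool" where
  "exchange a c X Z \<longleftrightarrow> X \<inter> Z = {} \<and> (\<otimes>) a ` X \<union> (\<otimes>) c ` Z = X \<union> Z"

lemma exchange_Un:
  assumes "exchange a c X Z" and "exchange a c X' Z'" and "(X \<union> Z) \<inter> (X' \<union> Z') = {}"
  shows "exchange a c (X \<union> X') (Z \<union> Z')"
  using assms unfolding exchange_def image_Un by blast

text \<open>The closure hypotheses make \<open>S\<close> a union of cosets of the four-element
  subgroup generated by \<open>a\<close> and \<open>c\<close>, and the induction removes one coset
  at a time. The bound may be attained with \<open>p\<close> and \<open>q\<close> odd, which is why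
  a coset must sometimes be shared.\<close>

lemma exists_exchange:
  assumes "a \<in> carrier G" "c \<in> carrier G" "a \<noteq> \<one>" "c \<noteq> \<one>" "a \<noteq> c"
    and "finite S" "S \<subseteq> carrier G"
    and "\<And>x. x \<in> S \<Longrightarrow> a \<otimes> x \<in> S" "\<And>x. x \<in> S \<Longrightarrow> c \<otimes> x \<in> S"
    and "2 * p + 2 * q \<le> card S"
  shows "\<exists>X Z. X \<subseteq> S \<and> Z \<subseteq> S \<and> card X = 2 * p \<and> card Z = 2 * q \<and> exchange a c X Z"
  using assms(6-)
proof (induction "card S" arbitrary: S p q rule: less_induct)
  case less
  note S = \<open>finite S\<close> \<open>S \<subseteq> carrier G\<close> \<open>\<And>x. x \<in> S \<Longrightarrow> a \<otimes> x \<in> S\<close> \<open>\<And>x. x \<in> S \<Longrightarrow> c \<otimes> x \<in> S\<close>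
  show ?case
  proof (cases "p = 0 \<and> q = 0")
    case True
    then show ?thesis by (auto simp: exchange_def intro!: exI [of _ "{}"])
  next
    case False
    with less.prems have "S \<noteq> {}" by auto
    then obtain w where w: "w \<in> S" by blast
    \<comment> \<open>The coset of \<open>w\<close> is a square: \<open>a\<close> swaps
      \<open>w\<close> with \<open>u\<close> and \<open>v\<close> with \<open>t\<close>, while
      \<open>c\<close> swaps \<open>w\<close> with \<open>v\<close> and \<open>u\<close> with
      \<open>t\<close>.\<close>
    define u v t where "u = a \<otimes> w" and "v = c \<otimes> w" and "t = a \<otimes> (c \<otimes> w)"
    have wc: "w \<in> carrier G" using w S by blast
    have ac: "a \<otimes> c \<noteq> \<one>" using assms mult_eq_one_iff by simp
    have img: "a \<otimes> w = u" "c \<otimes> w = v" "a \<otimes> u = w" "c \<otimes> v = w" "a \<otimes> v = t" "c \<otimes> u = t"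
      "a \<otimes> t = v" "c \<otimes> t = u"
      using assms wc by (simp_all add: u_def v_def t_def m_lcomm)
    have dist: "w \<noteq> u" "w \<noteq> v" "w \<noteq> t" "u \<noteq> v" "u \<noteq> t" "v \<noteq> t"
      using assms wc ac unfolding u_def v_def t_def
      by (auto simp: m_assoc [symmetric])
    define C where "C = {w, u, v, t}"
    have C: "C \<subseteq> S" using w S by (simp add: C_def u_def v_def t_def)
    have cardC: "card C = 4" using dist by (simp add: C_def)
    have Ca: "a \<otimes> x \<in> C" "c \<otimes> x \<in> C" if "x \<in> C" for x
      using that img by (auto simp: C_def)
    have cardSC: "card (S - C) = card S - 4" "4 \<le> card S"
      using C cardC S(1) card_mono [OF S(1) C] by (auto simp: card_Diff_subset finite_subset)
    \<comment> \<open>Multiplication by \<open>a\<close> or \<open>c\<close> is an involution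
      preserving \<open>C\<close>, so nothing outside \<open>C\<close> is sent into
      \<open>C\<close>.\<close>
    have inv: "a \<otimes> x \<in> S - C" "c \<otimes> x \<in> S - C" if "x \<in> S - C" for x
    proof -
      from that S(2) have x: "x \<in> S" "x \<notin> C" "x \<in> carrier G" by blast+
      then show "a \<otimes> x \<in> S - C" "c \<otimes> x \<in> S - C"
        using S(3,4) [OF x(1)] Ca(1) [of "a \<otimes> x"] Ca(2) [of "c \<otimes> x"] assms(1,2) by auto
    qed
    \<comment> \<open>Serve \<open>i\<close> of the \<open>p\<close> pairs and \<open>j\<close> of the \<open>q\<close> pairs inside the coset \<open>C\<close>.\<close>
    have step: ?thesis
      if "X0 \<subseteq> C" "Z0 \<subseteq> C" "card X0 = 2 * i" "card Z0 = 2 * j" "exchange a c X0 Z0"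
        "i \<le> p" "j \<le> q" "2 * (p - i) + 2 * (q - j) \<le> card S - 4" for X0 Z0 i j
    proof -
      have "\<exists>X Z. X \<subseteq> S - C \<and> Z \<subseteq> S - C \<and> card X = 2 * (p - i) \<and> card Z = 2 * (q - j)
          \<and> exchange a c X Z"
        using inv S(1,2) cardSC that by (intro less.hyps) auto
      then obtain X Z where XZ: "X \<subseteq> S - C" "Z \<subseteq> S - C" "card X = 2 * (p - i)"
        "card Z = 2 * (q - j)" "exchange a c X Z" by blast
      have fin: "finite X" "finite Z" "finite X0" "finite Z0"
        using XZ that C S by (meson finite_subset finite_Diff)+
      have "card (X0 \<union> X) = 2 * p" "card (Z0 \<union> Z) = 2 * q"
        using fin XZ(1-4) that by (subst card_Un_disjoint; auto)+
      moreover have "exchange a c (X0 \<union> X) (Z0 \<union> Z)"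
        using XZ that by (intro exchange_Un) auto
      ultimately show ?thesis
        using XZ that C by (intro exI [of _ "X0 \<union> X"] exI [of _ "Z0 \<union> Z"]) auto
    qed
    \<comment> \<open>The first three cases use up the whole coset, so the bound survives; the last
      two waste half of it, but then no demand remains.\<close>
    consider "p \<ge> 2" | "q \<ge> 2" | "p = 1" "q = 1" | "p = 1" "q = 0" | "p = 0" "q = 1"
      using False by linarith
    then show ?thesis
    proof cases
      case 1
      show ?thesis
        by (rule step [of C "{}" 2 0])
          (use 1 less.prems cardC img in \<open>auto simp: exchange_def C_def\<close>)
    next
      case 2
      show ?thesis
        by (rule step [of "{}" C 0 2])
          (use 2 less.prems cardC img in \<open>auto simp: exchange_def C_def\<close>)
    next
      case 3
      \<comment> \<open>\<open>a\<close> maps the diagonal \<open>{w, t}\<close> onto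
        \<open>{u, v}\<close>, and \<open>c\<close> maps \<open>{u, v}\<close> back onto
        \<open>{w, t}\<close>.\<close>
      show ?thesis
        by (rule step [of "{w, t}" "{u, v}" 1 1])
          (use 3 dist img in \<open>auto simp: exchange_def C_def\<close>)
    next
      case 4
      show ?thesis
        by (rule step [of "{w, u}" "{}" 1 0])
          (use 4 dist img in \<open>auto simp: exchange_def C_def\<close>)
    next
      case 5
      show ?thesis
        by (rule step [of "{}" "{w, v}" 0 1])
          (use 5 dist img in \<open>auto simp: exchange_def C_def\<close>)
    qed
  qed
qed

end

lemma elementary_abelian_2_group_Z2_power: "elementary_abelian_2_group (Z2_power k)"
proof -
  interpret comm_group "Z2_power k" by (rule comm_group_Z2_power)
  show ?thesis
    by unfold_locales (auto simp: Z2_power_def fun_eq_iff simp flip: mult_2)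
qed

section \<open>Rooted form of the caterpillar\<close>

text \<open>Every edge is named by its lower end, and commutativity makes its label independent of
  the orientation. The condition \<open>\<pi> (\<pi> v) \<noteq> v\<close> keeps two vertices from
  being each other's parents and thus naming the same edge.\<close>

lemma (in comm_group) rainbow_labeling_parent:
  assumes arcs: "parcs T = E \<union> E\<inverse>" "E = (\<lambda>v. (v, \<pi> v)) ` (pverts T - {r})"
    and parent: "\<And>v. v \<in> pverts T - {r} \<Longrightarrow> \<pi> v \<in> pverts T \<and> \<pi> (\<pi> v) \<noteq> v"
  shows "rainbow_labeling G T f \<longleftrightarrow> bij_betw f (pverts T) (carrier G) \<and>
    inj_on (\<lambda>v. f v \<otimes> f (\<pi> v)) (pverts T - {r})" (is "_ \<longleftrightarrow> ?bij \<and> inj_on ?g ?V")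
proof (cases ?bij)
  case True
  have com: "f u \<otimes> f v = f v \<otimes> f u" if "u \<in> pverts T" "v \<in> pverts T" for u v
    using that bij_betwE [OF True] by (simp add: m_comm)
  have arc: "(u, v) \<in> parcs T \<longleftrightarrow> (u \<in> ?V \<and> v = \<pi> u) \<or> (v \<in> ?V \<and> u = \<pi> v)" for u v
    using arcs by auto
  have edge: "{v, \<pi> v} = {w, \<pi> w} \<longleftrightarrow> v = w" if "v \<in> ?V" "w \<in> ?V" for v w
    using parent that by (metis doubleton_eq_iff)
  have "(\<forall>(u, v) \<in> parcs T. \<forall>(x, y) \<in> parcs T. {u, v} \<noteq> {x, y} \<longrightarrow> f u \<otimes> f v \<noteq> f x \<otimes> f y)
      \<longleftrightarrow> (\<forall>v \<in> ?V. \<forall>w \<in> ?V. {v, \<pi> v} \<noteq> {w, \<pi> w} \<longrightarrow> ?g v \<noteq> ?g w)" (is "?L \<longleftrightarrow> ?R")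
  proof
    assume ?L
    then show ?R using arc by blast
  next
    assume R: ?R
    have par: "\<exists>z \<in> ?V. {u, v} = {z, \<pi> z} \<and> f u \<otimes> f v = ?g z" if "(u, v) \<in> parcs T" for u v
      using that unfolding arc
    proof
      assume "u \<in> ?V \<and> v = \<pi> u"
      then show ?thesis by blast
    next
      assume v: "v \<in> ?V \<and> u = \<pi> v"
      then have "f u \<otimes> f v = ?g v" using com parent by blast
      with v show ?thesis by blast
    qed
    show ?L
    proof clarify
      fix u v x y
      assume "(u, v) \<in> parcs T" "(x, y) \<in> parcs T" and eq: "f u \<otimes> f v = f x \<otimes> f y"
        and ne: "{u, v} \<noteq> {x, y}"
      then obtain z z' where "z \<in> ?V" "{u, v} = {z, \<pi> z}" "f u \<otimes> f v = ?g z"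
        "z' \<in> ?V" "{x, y} = {z', \<pi> z'}" "f x \<otimes> f y = ?g z'"
        using par by meson
      with R eq ne show False by metis
    qed
  qed
  also have "\<dots> \<longleftrightarrow> inj_on ?g ?V"
    using edge by (auto simp: inj_on_def)
  finally show ?thesis using True by (simp add: rainbow_labeling_def)
qed (simp add: rainbow_labeling_def)

text \<open>A leaf has a single neighbour, which makes the leaf sets disjoint, and acyclicity rules
  out an edge between \<open>s1\<close> and \<open>s3\<close>. What remains is a parent map with
  root \<open>s2\<close>, in the form that \<open>rainbow_labeling_parent\<close> takes.\<close>

lemma caterpillar_spine3_structure:
  assumes cat: "caterpillar_with_spine T [s1, s2, s3]"
    and X: "X = attached_leaves T [s1, s2, s3] s1"
    and Y: "Y = attached_leaves T [s1, s2, s3] s2"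
    and Z: "Z = attached_leaves T [s1, s2, s3] s3"
    and \<pi>: "\<pi> = (\<lambda>v. if v \<in> X then s1 else if v \<in> Z then s3 else s2)"
  shows "finite (pverts T)" and "distinct [s1, s2, s3]"
    and "pverts T = {s1, s2, s3} \<union> X \<union> Y \<union> Z"
    and "{s1, s2, s3} \<inter> (X \<union> Y \<union> Z) = {}"
    and "X \<inter> Y = {}" and "Y \<inter> Z = {}" and "X \<inter> Z = {}"
    and "parcs T = (\<lambda>v. (v, \<pi> v)) ` (pverts T - {s2}) \<union> ((\<lambda>v. (v, \<pi> v)) ` (pverts T - {s2}))\<inverse>"
proof -
  from cat have tree: "undirected_tree T" and path: "vpath [s1, s2, s3] (with_proj T)"
    and off: "\<And>v. v \<in> pverts T - {s1, s2, s3} \<Longrightarrow> v \<in> X \<union> Y \<union> Z"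
    by (auto simp: caterpillar_with_spine_def X Y Z)
  from tree interpret pair_graph T by (simp add: undirected_tree_def)
  show "finite (pverts T)" by (rule pair_finite_verts)
  from path show dist: "distinct [s1, s2, s3]" by (simp add: vpath_def)
  from path have spine: "{s1, s2, s3} \<subseteq> pverts T" "(s1, s2) \<in> parcs T" "(s2, s3) \<in> parcs T"
    by (auto simp: vpath_def vwalk_def)
  have sym: "(v, u) \<in> parcs T" if "(u, v) \<in> parcs T" for u v
    using that pair_sym_arcs by (simp add: symmetric_def sym_def)
  have leafD: "v \<in> pverts T" "v \<notin> {s1, s2, s3}" "(s, v) \<in> parcs T" "(v, u) \<in> parcs T \<longleftrightarrow> u = s"
    if "v \<in> attached_leaves T [s1, s2, s3] s" for s v u
  proof -
    from that show v: "v \<in> pverts T" "v \<notin> {s1, s2, s3}" and a: "(s, v) \<in> parcs T"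
      by (auto simp: attached_leaves_def)
    \<comment> \<open>The reverse of \<open>(s, v)\<close> is an arc out of \<open>v\<close>, so it
      must be the only one.\<close>
    from that obtain e where e: "out_arcs T v = {e}"
      by (auto simp: attached_leaves_def leaf_def out_degree_def card_1_singleton_iff)
    have mem: "(v, u) \<in> parcs T \<longleftrightarrow> (v, u) = e" for u
      using e by (force simp: out_arcs_def set_eq_iff)
    show "(v, u) \<in> parcs T \<longleftrightarrow> u = s"
      using mem [of s] mem [of u] sym [OF a] by auto
  qed
  show verts: "pverts T = {s1, s2, s3} \<union> X \<union> Y \<union> Z"
    using off spine leafD(1) unfolding X Y Z by blast
  show disj: "{s1, s2, s3} \<inter> (X \<union> Y \<union> Z) = {}"
    using leafD(2) unfolding X Y Z by blast
  have uniq: "s = s'"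
    if "v \<in> attached_leaves T [s1, s2, s3] s" "v \<in> attached_leaves T [s1, s2, s3] s'" for v s s'
    using leafD(4) that by metis
  then show XY: "X \<inter> Y = {}" and YZ: "Y \<inter> Z = {}" and XZ: "X \<inter> Z = {}"
    using dist unfolding X Y Z by (metis disjoint_iff distinct_length_2_or_more)+
  \<comment> \<open>The chord would close a triangle, the shortest cycle that
    \<open>undirected_tree\<close> forbids.\<close>
  have no_chord: "(s3, s1) \<notin> parcs T"
  proof
    assume "(s3, s1) \<in> parcs T"
    then have "cycle [(s1, s2), (s2, s3), (s3, s1)]"
      using dist spine by (auto simp: cycle_def awalk_def)
    with tree show False
      by (force simp: undirected_tree_def)
  qed
  have leaf_arc: "(v, u) \<in> parcs T \<longleftrightarrow> u = \<pi> v" if "v \<in> X \<union> Y \<union> Z" for u v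
    using that leafD(4) XY YZ XZ unfolding \<pi> X Y Z by auto
  have spine_arc: "(u, v) \<in> parcs T \<longleftrightarrow> (u \<noteq> s2 \<and> v = \<pi> u) \<or> (v \<noteq> s2 \<and> u = \<pi> v)"
    if "u \<in> {s1, s2, s3}" "v \<in> {s1, s2, s3}" for u v
  proof -
    have "\<pi> s1 = s2" "\<pi> s2 = s2" "\<pi> s3 = s2" using disj by (auto simp: \<pi>)
    moreover have "(s2, s1) \<in> parcs T" "(s3, s2) \<in> parcs T" "(s1, s3) \<notin> parcs T"
      using spine sym no_chord by blast+
    moreover have "(v, v) \<notin> parcs T" for v
      using pair_no_loops by force
    ultimately show ?thesis
      using that dist spine no_chord by (elim insertE) auto
  qed
  have \<pi>_spine: "\<pi> v \<in> {s1, s2, s3}" for v by (simp add: \<pi>)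
  have "(u, v) \<in> parcs T \<longleftrightarrow>
      (u \<in> pverts T - {s2} \<and> v = \<pi> u) \<or> (v \<in> pverts T - {s2} \<and> u = \<pi> v)" for u v
  proof (cases "u \<in> pverts T \<and> v \<in> pverts T")
    case True
    then consider "u \<in> {s1, s2, s3}" "v \<in> {s1, s2, s3}"
      | "u \<in> X \<union> Y \<union> Z" | "v \<in> X \<union> Y \<union> Z"
      using verts by blast
    then show ?thesis
    proof cases
      case 1
      with True show ?thesis using spine_arc by blast
    next
      case 2
      then show ?thesis using leaf_arc [OF 2] True disj \<pi>_spine by blast
    next
      case 3
      then show ?thesis using leaf_arc [OF 3] True disj \<pi>_spine sym by blast
    qed
  next
    case False
    then show ?thesis using in_arcsD1 in_arcsD2 \<pi>_spine spine(1) by blast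
  qed
  then show "parcs T = (\<lambda>v. (v, \<pi> v)) ` (pverts T - {s2})
      \<union> ((\<lambda>v. (v, \<pi> v)) ` (pverts T - {s2}))\<inverse>"
    by auto
qed

section \<open>The equivalence in an elementary abelian 2-group of even order\<close>

theorem (in elementary_abelian_2_group) rainbow_caterpillar_spine3_iff:
  assumes cat: "caterpillar_with_spine T [s1, s2, s3]"
    and card_verts: "card (pverts T) = order G" and "even (order G)"
    and X: "X = attached_leaves T [s1, s2, s3] s1"
    and Y: "Y = attached_leaves T [s1, s2, s3] s2"
    and Z: "Z = attached_leaves T [s1, s2, s3] s3"
  shows "rainbow G T \<longleftrightarrow> even (card X) \<and> even (card Z) \<and> odd (card Y)"
proof -
  define \<pi> where "\<pi> = (\<lambda>v. if v \<in> X then s1 else if v \<in> Z then s3 else s2)"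
  note struct = caterpillar_spine3_structure [OF cat X Y Z \<pi>_def]
  let ?V = "pverts T"
  let ?W = "?V - {s2}"
  have finV: "finite ?V" and dist: "distinct [s1, s2, s3]" by (fact struct)+
  have fin: "finite X" "finite Y" "finite Z"
    using finV struct(3) by auto
  have W: "?W = insert s1 (insert s3 (X \<union> Y \<union> Z))"
    using dist struct(3,4) by auto
  have V: "?V = insert s1 (insert s2 (insert s3 (X \<union> Y \<union> Z)))"
    using struct(3) by auto
  have off: "{s1, s2, s3} \<inter> X = {}" "{s1, s2, s3} \<inter> Y = {}" "{s1, s2, s3} \<inter> Z = {}"
    using struct(4) by blast+
  have \<pi>: "\<pi> s1 = s2" "\<pi> s2 = s2" "\<pi> s3 = s2" "\<And>v. v \<in> X \<Longrightarrow> \<pi> v = s1"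
    "\<And>v. v \<in> Y \<Longrightarrow> \<pi> v = s2" "\<And>v. v \<in> Z \<Longrightarrow> \<pi> v = s3"
    using off struct(5-7) by (auto simp: \<pi>_def)
  have \<pi>V: "\<pi> v \<in> ?V" "\<pi> v \<noteq> v" "\<pi> (\<pi> v) \<noteq> v" if "v \<in> ?W" for v
  proof -
    have s: "s1 \<in> ?V" "s2 \<in> ?V" "s3 \<in> ?V" using struct(3) by auto
    from that have "v \<in> {s1, s3} \<or> v \<in> X \<or> v \<in> Y \<or> v \<in> Z" and ne: "v \<noteq> s2"
      using W by blast+
    then consider "v \<in> {s1, s3}" | "v \<in> X" | "v \<in> Y" | "v \<in> Z" by blast
    then have "\<pi> v \<in> ?V \<and> \<pi> v \<noteq> v \<and> \<pi> (\<pi> v) \<noteq> v"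
      by cases (use ne dist \<pi>(1-3) \<pi>(4-6) [of v] s off in auto)
    then show "\<pi> v \<in> ?V" "\<pi> v \<noteq> v" "\<pi> (\<pi> v) \<noteq> v" by blast+
  qed
  have labeling: "rainbow_labeling G T f \<longleftrightarrow>
      bij_betw f ?V (carrier G) \<and> inj_on (\<lambda>v. f v \<otimes> f (\<pi> v)) ?W" for f
    using \<pi>V by (intro rainbow_labeling_parent [OF struct(8) refl]) blast
  have cardL: "card (X \<union> Y \<union> Z) = card X + card Y + card Z"
    using fin struct(5-7) by (simp add: card_Un_disjoint Int_Un_distrib2)
  have cardV: "card ?V = 3 + card X + card Y + card Z"
    using dist off fin cardL unfolding V by simp
  have finG: "finite (carrier G)" and cardG: "card (carrier G) = 3 + card X + card Y + card Z"
    using card_verts cardV by (auto simp: order_def intro: card_ge_0_finite)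
  \<comment> \<open>There are as many edges as non-identity elements. This turns injectivity of the
    edge labels into surjectivity below, and surjectivity into injectivity in the converse.\<close>
  have cardW: "card ?W = card (carrier G - {\<one>})"
    using cardV cardG finV finG V by (simp add: card_Diff_singleton)
  have parity: "odd (card X + card Y + card Z)"
    using \<open>even (order G)\<close> cardG unfolding order_def by presburger
  show ?thesis
  proof

    \<comment> \<open>Necessity of the parities\<close>
    assume "rainbow G T"
    then obtain f where f: "bij_betw f ?V (carrier G)" and
      inj: "inj_on (\<lambda>v. f v \<otimes> f (\<pi> v)) ?W" (is "inj_on ?g _")
      using labeling by (auto simp: rainbow_def)
    define a b c where "a = f s1" and "b = f s2" and "c = f s3"
    have fV: "f v \<in> carrier G" if "v \<in> ?V" for v
      using f that by (auto simp: bij_betw_def)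
    have abc: "a \<in> carrier G" "b \<in> carrier G" "c \<in> carrier G"
      using fV V by (auto simp: a_def b_def c_def)
    have f_eq: "f u = f v \<longleftrightarrow> u = v" if "u \<in> ?V" "v \<in> ?V" for u v
      using f that by (auto simp: bij_betw_def dest: inj_onD)
    have ne: "a \<noteq> b" "b \<noteq> c" "a \<noteq> c"
      using f_eq dist V by (auto simp: a_def b_def c_def)
    have f\<pi>: "f (\<pi> s1) = b" "f (\<pi> s3) = b" "\<And>v. v \<in> X \<Longrightarrow> f (\<pi> v) = a"
      "\<And>v. v \<in> Y \<Longrightarrow> f (\<pi> v) = b" "\<And>v. v \<in> Z \<Longrightarrow> f (\<pi> v) = c"
      using \<pi> by (simp_all add: a_def b_def c_def)
    have "?g ` ?W \<subseteq> carrier G - {\<one>}"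
    proof
      fix x assume "x \<in> ?g ` ?W"
      then obtain v where v: "v \<in> ?W" "x = ?g v" by blast
      then show "x \<in> carrier G - {\<one>}"
        using \<pi>V [OF v(1)] fV [of v] fV [of "\<pi> v"] f_eq [of v "\<pi> v"] by (auto simp: mult_eq_one_iff)
    qed
    then have gW: "?g ` ?W = carrier G - {\<one>}"
      using inj cardW finG by (intro card_subset_eq) (auto simp: card_image)
    \<comment> \<open>The product of all group elements is computed twice: the vertex labels give
      \<open>b \<otimes> Q\<close>, and the edge labels give \<open>Q\<close> times the product of
      the labels of all parents. Then \<open>Q\<close> cancels.\<close>
    define Q where "Q = finprod G f ?W"
    have Q: "Q \<in> carrier G" using fV by (auto simp: Q_def)
    have "b \<otimes> Q = finprod G f ?V"
    proof -
      have "finprod G f (insert s2 ?W) = f s2 \<otimes> finprod G f ?W"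
        using finV fV abc by (intro finprod_insert) (auto simp: b_def)
      moreover have "insert s2 ?W = ?V" using V by blast
      ultimately show ?thesis by (simp add: Q_def b_def)
    qed
    also have "\<dots> = finprod G (\<lambda>x. x) (f ` ?V)"
      using f fV by (subst finprod_reindex) (auto simp: bij_betw_def)
    also have "f ` ?V = carrier G"
      using f by (simp add: bij_betw_def)
    also have "finprod G (\<lambda>x. x) (carrier G) = finprod G (\<lambda>x. x) (carrier G - {\<one>})"
      using finG by (intro finprod_mono_neutral_cong_right) auto
    also have "\<dots> = finprod G ?g ?W"
      unfolding gW [symmetric] using inj fV \<pi>V by (subst finprod_reindex) auto
    also have "\<dots> = Q \<otimes> finprod G (\<lambda>v. f (\<pi> v)) ?W"
      using fV \<pi>V by (subst finprod_multf) (auto simp: Q_def)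
    \<comment> \<open>Both \<open>s1\<close> and \<open>s3\<close> have parent \<open>s2\<close>, so
      \<open>b\<close> occurs twice and cancels, leaving the leaves.\<close>
    also have "finprod G (\<lambda>v. f (\<pi> v)) ?W =
        b \<otimes> (b \<otimes> finprod G (\<lambda>v. f (\<pi> v)) (X \<union> Y \<union> Z))"
    proof -
      have "(\<lambda>v. f (\<pi> v)) \<in> X \<union> Y \<union> Z \<rightarrow> carrier G"
        using abc f\<pi> by auto
      then show ?thesis
        unfolding W using dist off fin f\<pi>(1,2) abc by simp
    qed
    also have "\<dots> = finprod G (\<lambda>v. f (\<pi> v)) (X \<union> Y \<union> Z)"
      using abc f\<pi>(3-5) by (intro mult_self_cancel finprod_closed) auto
    also have "\<dots> = finprod G (\<lambda>v. f (\<pi> v)) X \<otimes> finprod G (\<lambda>v. f (\<pi> v)) Y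
        \<otimes> finprod G (\<lambda>v. f (\<pi> v)) Z"
      using abc f\<pi>(3-5) fin struct(5-7)
      by (simp add: finprod_Un_disjoint Int_Un_distrib2 Pi_def)
    also have "finprod G (\<lambda>v. f (\<pi> v)) X = finprod G (\<lambda>_. a) X"
      using abc f\<pi>(3) by (intro finprod_cong') auto
    also have "finprod G (\<lambda>v. f (\<pi> v)) Y = finprod G (\<lambda>_. b) Y"
      using abc f\<pi>(4) by (intro finprod_cong') auto
    also have "finprod G (\<lambda>v. f (\<pi> v)) Z = finprod G (\<lambda>_. c) Z"
      using abc f\<pi>(5) by (intro finprod_cong') auto
    finally have "Q \<otimes> b = Q \<otimes> (a [^] card X \<otimes> b [^] card Y \<otimes> c [^] card Z)"
      using abc Q by (simp add: finprod_const m_comm [of b])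
    then have "b = a [^] card X \<otimes> b [^] card Y \<otimes> c [^] card Z"
      using abc Q by simp
    \<comment> \<open>This excludes three odd sizes, where the equation would force
      \<open>a = c\<close>. If just one of \<open>card X\<close> and \<open>card Z\<close> is odd,
      then \<open>card Y\<close> is even and the equation reads \<open>b = a\<close> or
      \<open>b = c\<close>.\<close>
    moreover have "a \<otimes> (b \<otimes> c) \<noteq> b"
      using abc ne by (simp add: m_lcomm [of a b] mult_eq_one_iff)
    ultimately show "even (card X) \<and> even (card Z) \<and> odd (card Y)"
      using abc ne parity
      by (cases "even (card X)"; cases "even (card Z)")
        (auto simp: pow_parity m_comm m_lcomm m_assoc)
  next

    \<comment> \<open>Sufficiency: construction of a labeling\<close>
    assume even: "even (card X) \<and> even (card Z) \<and> odd (card Y)"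
    then have cardG4: "card (carrier G) \<ge> 4" using cardG by (auto elim: oddE)
    have "\<not> carrier G \<subseteq> {\<one>}"
      using cardG4 card_mono [of "{\<one>}" "carrier G"] by auto
    then obtain a where a: "a \<in> carrier G" "a \<noteq> \<one>" by blast
    have "\<not> carrier G \<subseteq> {\<one>, a}"
      using cardG4 a(2) [symmetric] card_mono [of "{\<one>, a}" "carrier G"] by auto
    then obtain c where c: "c \<in> carrier G" "c \<noteq> \<one>" "a \<noteq> c" by blast
    have ac: "a \<otimes> c \<in> carrier G" "a \<otimes> c \<noteq> \<one>" "a \<otimes> c \<noteq> a" "a \<otimes> c \<noteq> c"
      using a c by (auto simp: mult_eq_one_iff)
    \<comment> \<open>The subgroup generated by the spine labels \<open>\<one>\<close>,
      \<open>a\<close>, \<open>c\<close>. Its fourth element \<open>a \<otimes> c\<close> is kept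
      out of \<open>S\<close> and will label a leaf at \<open>s2\<close>.\<close>
    define H where "H = {\<one>, a, c, a \<otimes> c}"
    have H: "H \<subseteq> carrier G" "card H = 4"
      using a c ac by (auto simp: H_def)
    have H_mult: "a \<otimes> x \<in> H" "c \<otimes> x \<in> H" if "x \<in> H" for x
      using that a c by (auto simp: H_def square_one m_comm m_lcomm)
    define S where "S = carrier G - H"
    have S_mult: "a \<otimes> x \<in> S" "c \<otimes> x \<in> S" if "x \<in> S" for x
      using that H_mult [of "a \<otimes> x"] H_mult [of "c \<otimes> x"] a c by (auto simp: S_def)
    obtain p q where pq: "card X = 2 * p" "card Z = 2 * q"
      using even by (auto elim!: evenE)
    have "card S = card (carrier G) - 4"
      using H finG by (simp add: S_def card_Diff_subset finite_subset)
    \<comment> \<open>As \<open>card Y\<close> is odd, it is at least 1, which pays for the element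
      \<open>a \<otimes> c\<close> removed along with the three spine labels.\<close>
    then have "2 * p + 2 * q \<le> card S"
      using cardG pq even by (auto elim: oddE)
    then obtain X' Z' where X'Z': "X' \<subseteq> S" "Z' \<subseteq> S" "card X' = card X" "card Z' = card Z"
      "X' \<inter> Z' = {}" "(\<otimes>) a ` X' \<union> (\<otimes>) c ` Z' = X' \<union> Z'"
      using exists_exchange [of a c S p q] a c S_mult finG pq
      by (auto simp: S_def exchange_def)
    define Y' where "Y' = carrier G - ({\<one>, a, c} \<union> X' \<union> Z')"
    have fin': "finite X'" "finite Z'" "finite Y'"
      using X'Z' finG by (auto simp: S_def Y'_def intro: finite_subset)
    have out: "{\<one>, a, c} \<inter> (X' \<union> Z') = {}" and sub: "X' \<union> Z' \<subseteq> carrier G"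
      using X'Z' by (auto simp: S_def H_def)
    have "card ({\<one>, a, c} \<union> X' \<union> Z') = 3 + card X + card Z"
      using a c out fin' X'Z' by (simp add: card_Un_disjoint Int_Un_distrib2)
    then have "card Y' = card Y"
      using cardG a c sub fin' by (simp add: Y'_def card_Diff_subset)
    then obtain h i j where "bij_betw h X X'" "bij_betw i Y Y'" "bij_betw j Z Z'"
      using fin fin' X'Z' by (metis finite_same_card_bij)
    then have hij: "h ` X = X'" "i ` Y = Y'" "j ` Z = Z'"
      by (auto simp: bij_betw_def)
    \<comment> \<open>The final default \<open>\<one>\<close> is the label of
      \<open>s2\<close>.\<close>
    define f where "f v = (if v \<in> X then h v else if v \<in> Y then i v else if v \<in> Z then j v
      else if v = s1 then a else if v = s3 then c else \<one>)" for v
    have f_spine: "f s1 = a" "f s2 = \<one>" "f s3 = c"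
      using off dist by (auto simp: f_def)
    have f_leaves: "f ` X = X'" "f ` Y = Y'" "f ` Z = Z'"
      using hij struct(5-7) by (auto simp: f_def)
    let ?g = "\<lambda>v. f v \<otimes> f (\<pi> v)"
    have fV: "f ` ?V = carrier G"
      unfolding V image_insert image_Un f_leaves f_spine using a c sub by (auto simp: Y'_def)
    moreover from this have "inj_on f ?V"
      using cardV cardG finV by (simp add: eq_card_imp_inj_on)
    moreover have "inj_on ?g ?W"
    proof -
      have "f v \<in> carrier G" if "v \<in> X \<union> Y \<union> Z" for v
        using fV V that by blast
      then have g: "\<And>v. v \<in> X \<Longrightarrow> ?g v = a \<otimes> f v" "\<And>v. v \<in> Z \<Longrightarrow> ?g v = c \<otimes> f v"
        "\<And>v. v \<in> Y \<Longrightarrow> ?g v = f v"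
        using \<pi>(4-6) f_spine a c by (simp_all add: m_comm)
      have "?g ` X = (\<otimes>) a ` f ` X" "?g ` Z = (\<otimes>) c ` f ` Z" "?g ` Y = f ` Y"
        unfolding image_image using g by (simp_all cong: image_cong)
      \<comment> \<open>Since \<open>s2\<close> has label \<open>\<one>\<close>, the edges at
        \<open>s2\<close> carry the labels of their lower ends. By the exchange property the other
        edges permute the labels in \<open>X' \<union> Z'\<close>, so every non-identity element is
        reached and counting gives injectivity.\<close>
      then have "?g ` ?W = {a, c} \<union> ((\<otimes>) a ` X' \<union> (\<otimes>) c ` Z') \<union> Y'"
        unfolding W image_insert image_Un f_leaves using \<pi> f_spine a c by auto
      also have "\<dots> = carrier G - {\<one>}"
        unfolding X'Z' using a c out sub by (auto simp: Y'_def)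
      finally show ?thesis
        using cardW finV by (simp add: eq_card_imp_inj_on)
    qed
    ultimately show "rainbow G T"
      using labeling by (auto simp: rainbow_def bij_betw_def)
  qed
qed

theorem theorem7:
  fixes k :: nat and T :: "'v pair_pre_digraph" and s1 s2 s3 :: 'v and X Y Z :: "'v set"
  assumes "k > 1"
    and "caterpillar_with_spine T [s1, s2, s3]"
    and "card (pverts T) = 2 ^ k"
    and "X = attached_leaves T [s1, s2, s3] s1"
    and "Y = attached_leaves T [s1, s2, s3] s2"
    and "Z = attached_leaves T [s1, s2, s3] s3"
  shows "rainbow (Z2_power k) T \<longleftrightarrow> even (card X) \<and> even (card Z) \<and> odd (card Y)"
proof -
  interpret elementary_abelian_2_group "Z2_power k"
    by (rule elementary_abelian_2_group_Z2_power)
  show ?thesis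
    using assms by (intro rainbow_caterpillar_spine3_iff) (simp_all add: order_Z2_power)
qed

end
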